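(* Let $d_{\mathrm{in}}, d_{\mathrm{out}}, r$ be positive integers, let $\alpha>0$ and $\eta>0$ be real numbers, let $\mathcal{L}:\mathbb{R}^{d_{\mathrm{in}}\times d_{\mathrm{out}}}\to\mathbb{R}$, $W\mapsto \mathcal{L}(W)$, be a differentiable loss function, let $W'\in\mathbb{R}^{d_{\mathrm{in}}\times d_{\mathrm{out}}}$ be fixed, and let $A\in\mathbb{R}^{d_{\mathrm{in}}\times r}$ be fixed with orthonormal columns, $A^{\top}A=I_r$. For $B\in\mathbb{R}^{r\times d_{\mathrm{out}}}$ put $W=W'+\frac{\alpha}{r}AB$ and let $G=\nabla_W\mathcal{L}(W)\in\mathbb{R}^{d_{\mathrm{in}}\times d_{\mathrm{out}}}$ be the gradient of $\mathcal{L}$ at this $W$. Then optimizing only $B$ by gradient descent with learning rate $\eta$ (with $A$ and $W'$ frozen) is equivalent to performing gradient descent on $W$ along the orthogonal projection of $G$ onto $\mathrm{span}(A)$. Precisely: if $\Delta B=-\eta\,\nabla_B\big[\mathcal{L}(W'+\frac{\alpha}{r}AB)\big]$ is the change of $B$ in one gradient descent step, then the induced change $\Delta W=\frac{\alpha}{r}A\,\Delta B$ of $W$ satisfies $$\Delta W=\frac{\alpha}{r}A\,\Delta B=-c\,AA^{\top}G,\qquad c=\frac{\eta\alpha^{2}}{r^{2}}>0,$$ where $AA^{\top}G$ is the orthogonal projection of $G$ (column by column) onto $\mathrm{span}(A)$.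
   Context: This models low-rank adaptation (LoRA) with a frozen down-projection: a weight matrix $W$ is parametrized as $W'+\frac{\alpha}{r}AB$, with $W'$ and $A$ frozen and only $B$ trained; $\mathcal{L}$ is the loss of the current task as a function of the weight matrix. $\mathrm{span}(A)\subseteq\mathbb{R}^{d_{\mathrm{in}}}$ is the column space of $A$. Gradients with respect to matrices are taken with respect to the Frobenius (trace) inner product $\langle X,Y\rangle=\mathrm{tr}(X^{\top}Y)$, so $\nabla_B$ of a scalar function is the $r\times d_{\mathrm{out}}$ matrix of its partial derivatives in the entries of $B$. *)

theory Defs
  imports "HOL-Analysis.Analysis"
begin

text \<open>
  A matrix in \<open>\<real>\<^sup>m\<^sup>\<times>\<^sup>n\<close> is a term of type \<open>real ^ 'n ^ 'm\<close>. The
  inner product of this type is the Frobenius inner product: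
\<close>

lemma inner_matrix_eq_trace:
  fixes X Y :: "real ^ 'n ^ 'm"
  shows "inner X Y = trace (transpose X ** Y)"
  unfolding inner_vec_def trace_def transpose_def matrix_matrix_mult_def
  by (simp, rule sum.swap)

text \<open>
  The gradient with respect to the inner product of the space; on matrices this is the
  Frobenius gradient. It is only meaningful where \<open>f\<close> is differentiable.
\<close>

definition grad :: "('a::real_inner \<Rightarrow> real) \<Rightarrow> 'a \<Rightarrow> 'a" where
  "grad f x = (THE D. GDERIV f x :> D)"

lemma GDERIV_grad:
  fixes f :: "'a::euclidean_space \<Rightarrow> real"
  assumes "f differentiable (at x)"
  shows "GDERIV f x :> grad f x"
proof -
  obtain f' where f': "(f has_derivative f') (at x)"
    using assms by (auto simp: differentiable_def)
  then have lin: "linear f'"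
    by (rule has_derivative_linear)
  have "f' = (\<lambda>h. inner h (adjoint f' 1))"
    using adjoint_works[OF lin, of _ 1] by (auto simp: fun_eq_iff)
  with f' have *: "GDERIV f x :> adjoint f' 1"
    by (simp add: gderiv_def)
  moreover have "D = adjoint f' 1" if "GDERIV f x :> D" for D
  proof -
    have "(\<lambda>h. inner h D) = (\<lambda>h. inner h (adjoint f' 1))"
      using that * unfolding gderiv_def by (rule has_derivative_unique)
    then show ?thesis
      using vector_eq_ldot[of D "adjoint f' 1"] by (simp add: fun_eq_iff)
  qed
  ultimately show ?thesis
    unfolding grad_def by (rule theI[where P = "\<lambda>D. GDERIV f x :> D"])
qed

definition is_orth_proj :: "'a::real_inner set \<Rightarrow> 'a \<Rightarrow> 'a \<Rightarrow> bool" where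
  "is_orth_proj S x p \<longleftrightarrow> p \<in> S \<and> (\<forall>y\<in>S. orthogonal (x - p) y)"

text \<open>The rank \<open>r\<close> is \<open>CARD('r)\<close>.\<close>

definition lora_weight ::
    "real \<Rightarrow> real ^ 'n ^ 'm \<Rightarrow> real ^ 'r ^ 'm \<Rightarrow> real ^ 'n ^ 'r \<Rightarrow> real ^ 'n ^ 'm" where
  "lora_weight \<alpha> W' A B = W' + (\<alpha> / real CARD('r)) *\<^sub>R (A ** B)"

end

theory Submission
  imports Defs
begin

text \<open>
  By the chain rule the gradient in \<open>B\<close> is \<open>(\<alpha> / r) A\<^sup>T G\<close>, because left multiplication
  by \<open>A\<^sup>T\<close> is the Frobenius adjoint of left multiplication by \<open>A\<close>. Pushing the step
  back to \<open>W\<close> applies \<open>(\<alpha> / r) A\<close> once more, and \<open>A A\<^sup>T\<close> is the orthogonal projection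
  onto the column space because the columns of \<open>A\<close> are orthonormal.
\<close>

text \<open>Makes \<open>grad\<close> computable from any exhibited derivative: derivatives are
  unique, and a vector is determined by its inner products.\<close>

lemma grad_eqI:
  fixes f :: "'a::euclidean_space \<Rightarrow> real"
  assumes "GDERIV f x :> D"
  shows "grad f x = D"
proof -
  have "f differentiable (at x)"
    using assms by (auto simp: gderiv_def differentiable_def)
  then have "GDERIV f x :> grad f x"
    by (rule GDERIV_grad)
  then have "(\<lambda>h. inner h (grad f x)) = (\<lambda>h. inner h D)"
    using assms unfolding gderiv_def by (rule has_derivative_unique)
  then show ?thesis
    using vector_eq_ldot[of "grad f x" D] by (simp add: fun_eq_iff)
qed

text \<open>Both sides are the trace of the triple product of \<open>transpose B\<close>,
  \<open>transpose A\<close> and \<open>G\<close>.\<close>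

lemma inner_matrix_mul_left:
  fixes A :: "real ^ 'r ^ 'm" and B :: "real ^ 'n ^ 'r" and G :: "real ^ 'n ^ 'm"
  shows "inner (A ** B) G = inner B (transpose A ** G)"
  by (simp add: inner_matrix_eq_trace matrix_transpose_mul matrix_mul_assoc)

lemma bounded_linear_matrix_mul_left:
  fixes A :: "real ^ 'r ^ 'm"
  shows "bounded_linear (\<lambda>B :: real ^ 'n ^ 'r. A ** B)"
  by (intro linear_conv_bounded_linear[THEN iffD1] linearI)
    (simp_all add: matrix_matrix_mult_def vec_eq_iff sum_distrib_left mult.left_commute
      distrib_left sum.distrib)

lemma grad_lora_weight:
  fixes f :: "real ^ 'n ^ 'm \<Rightarrow> real" and A :: "real ^ 'r ^ 'm"
  assumes "f differentiable (at (lora_weight \<alpha> W' A B))"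
  shows "grad (\<lambda>B. f (lora_weight \<alpha> W' A B)) B =
    (\<alpha> / real CARD('r)) *\<^sub>R (transpose A ** grad f (lora_weight \<alpha> W' A B))"
proof (rule grad_eqI)
  let ?k = "\<alpha> / real CARD('r)" and ?G = "grad f (lora_weight \<alpha> W' A B)"
  have "(lora_weight \<alpha> W' A has_derivative (\<lambda>h. ?k *\<^sub>R (A ** h))) (at B)"
    unfolding lora_weight_def
    by (auto intro!: derivative_eq_intros
        bounded_linear.has_derivative[OF bounded_linear_matrix_mul_left])
  moreover have "(f has_derivative (\<lambda>h. inner h ?G)) (at (lora_weight \<alpha> W' A B))"
    using GDERIV_grad[OF assms] by (simp add: gderiv_def)
  ultimately have "((\<lambda>B. f (lora_weight \<alpha> W' A B)) has_derivative
      (\<lambda>h. inner (?k *\<^sub>R (A ** h)) ?G)) (at B)"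
    by (rule has_derivative_compose)
  then show "GDERIV (\<lambda>B. f (lora_weight \<alpha> W' A B)) B :> ?k *\<^sub>R (transpose A ** ?G)"
    by (simp add: gderiv_def inner_matrix_mul_left)
qed

text \<open>Orthonormality makes \<open>transpose A\<close> annihilate the residual, and the kernel
  of \<open>transpose A\<close> is the orthogonal complement of the range of
  \<open>A\<close>.\<close>

lemma is_orth_proj_span_columns:
  fixes A :: "real ^ 'r ^ 'm"
  assumes "transpose A ** A = mat 1"
  shows "is_orth_proj (span (columns A)) g ((A ** transpose A) *v g)"
  unfolding is_orth_proj_def
proof (intro conjI ballI)
  show "(A ** transpose A) *v g \<in> span (columns A)"
    by (simp add: matrix_vector_mult_in_columnspace flip: matrix_vector_mul_assoc)
next
  let ?e = "g - (A ** transpose A) *v g"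
  have "transpose A *v ?e = 0"
    by (simp add: matrix_vector_mult_diff_distrib matrix_vector_mul_assoc matrix_mul_assoc assms)
  then have "orthogonal ?e (A *v x)" for x
    by (simp add: orthogonal_def flip: dot_lmul_matrix)
  \<comment> \<open>Each column is the image of a basis vector, and orthogonality on this spanning
    set extends to the span.\<close>
  moreover have "\<exists>x. z = A *v x" if "z \<in> columns A" for z
    using that by (auto simp: columns_def simp flip: matrix_vector_mult_basis)
  ultimately show "orthogonal ?e y" if "y \<in> span (columns A)" for y
    by (intro orthogonal_to_span[OF that]) blast
qed

theorem proposition3p1:
  fixes \<L> :: "real ^ 'dout ^ 'din \<Rightarrow> real"
    and W' W G \<Delta>W :: "real ^ 'dout ^ 'din"
    and A :: "real ^ 'r ^ 'din"
    and B \<Delta>B :: "real ^ 'dout ^ 'r"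
    and \<alpha> \<eta> c :: real
  assumes "\<alpha> > 0" and "\<eta> > 0"
    and "\<And>X. \<L> differentiable (at X)"
    and "transpose A ** A = mat 1"
    and "W = lora_weight \<alpha> W' A B"
    and "G = grad \<L> W"
    and "\<Delta>B = - \<eta> *\<^sub>R grad (\<lambda>B. \<L> (lora_weight \<alpha> W' A B)) B"
    and "\<Delta>W = lora_weight \<alpha> W' A (B + \<Delta>B) - W"
    and "c = \<eta> * \<alpha>\<^sup>2 / (real CARD('r))\<^sup>2"
  shows "\<Delta>W = (\<alpha> / real CARD('r)) *\<^sub>R (A ** \<Delta>B)
    \<and> (\<alpha> / real CARD('r)) *\<^sub>R (A ** \<Delta>B) = - c *\<^sub>R (A ** transpose A ** G)
    \<and> c > 0
    \<and> (\<forall>j. is_orth_proj (span (columns A)) (column j G) (column j (A ** transpose A ** G)))"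
proof -
  let ?k = "\<alpha> / real CARD('r)"
  \<comment> \<open>The weight is affine in \<open>B\<close>, so \<open>W'\<close> cancels and the
    identity is exact, not merely first order in \<eta>.\<close>
  have dW: "\<Delta>W = ?k *\<^sub>R (A ** \<Delta>B)"
    by (simp add: assms(5,8) lora_weight_def matrix_add_ldistrib scaleR_add_right)
  have "\<Delta>B = (- \<eta> * ?k) *\<^sub>R (transpose A ** G)"
    using assms(3) by (simp add: assms(5-7) grad_lora_weight)
  moreover have "A ** (s *\<^sub>R X) = s *\<^sub>R (A ** X)" for s and X :: "real ^ 'dout ^ 'r"
    by (intro linear_scale bounded_linear.linear bounded_linear_matrix_mul_left)
  ultimately have "?k *\<^sub>R (A ** \<Delta>B) = (?k * (- \<eta> * ?k)) *\<^sub>R (A ** transpose A ** G)"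
    by (simp only: matrix_mul_assoc scaleR_scaleR)
  \<comment> \<open>One factor \<open>?k\<close> comes from the chain rule, the other from mapping
    \<open>\<Delta>B\<close> back to the weights; hence the squares in \<open>c\<close>.\<close>
  also have "?k * (- \<eta> * ?k) = - c"
    by (simp add: assms(9) power2_eq_square)
  finally have step: "?k *\<^sub>R (A ** \<Delta>B) = - c *\<^sub>R (A ** transpose A ** G)" .
  have "c > 0"
    using assms(1,2) by (simp add: assms(9))
  \<comment> \<open>Left multiplication acts on each column separately, which reduces the matrix
    claim to the vector projection.\<close>
  moreover have "column j (A ** transpose A ** G) = (A ** transpose A) *v column j G" for j
    by (simp add: vec_eq_iff column_def matrix_matrix_mult_def matrix_vector_mult_def)
  ultimately show ?thesis
    using dW step is_orth_proj_span_columns[OF assms(4)] by simp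
qed

end
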